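(* Let $A$ be an open subset of $\mathbb{E}^n$ such that either $A$ is bounded or its boundary $\partial A$ is unbounded. Let $\delta_A$ be the Apollonian weak metric, $\eta_A$ the half-Apollonian semi-metric and $\alpha_A$ the Apollonian semi-metric of $A$. Then $$\sigma\delta_A=\eta_A\qquad\text{and}\qquad S\delta_A=\alpha_A.$$
   Context: $\mathbb{E}^n$ is Euclidean $n$-space, $|x-y|$ is the Euclidean distance, $\partial A=\overline{A}\setminus A$. For $x,y\in A$: - the Apollonian weak metric is $\delta_A(x,y)=\sup_{a\in\partial A}\log\frac{|x-a|}{|y-a|}$; - the half-Apollonian semi-metric is $\eta_A(x,y)=\sup_{a\in\partial A}\left|\log\frac{|x-a|}{|y-a|}\right|$; - the Apollonian semi-metric is $\alpha_A(x,y)=\sup_{a\in\partial A}\log\frac{|x-a|}{|y-a|}+\sup_{b\in\partial A}\log\frac{|y-b|}{|x-b|}$. A weak metric on a set $X$ is a function $\delta:X\times X\to[0,\infty)$ with $\delta(x,x)=0$ and $\delta(x,y)+\delta(y,z)\ge\delta(x,z)$ for all $x,y,z\in X$; a semi-metric is a symmetric weak metric. For a weak metric $\delta$, its max-symmetrization is $\sigma\delta(x,y)=\max\{\delta(x,y),\delta(y,x)\}$ and its mean-value symmetrization is $S\delta(x,y)=\frac12(\delta(x,y)+\delta(y,x))$.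
   Formalization: With S carrying the factor 1/2 and α_A defined as the sum of two suprema without it, Sδ_A = α_A fails (unit ball, x = 0, |y| = 1/2); the second equation is corrected to Sδ_A = (1/2)α_A. *)

theory Defs
  imports "HOL-Analysis.Analysis"
begin

(* This is the boundary used for all the functions below.  It agrees with
   the library's frontier exactly when A is open. *)
definition bdry :: "'a::topological_space set \<Rightarrow> 'a set" where
  "bdry A = closure A - A"

(* The suprema are suprema of reals.  If A is open and is either bounded or has
   unbounded boundary, then for x, y in A every index set below is nonempty and every
   family is bounded above, so the values outside the usual domain of Sup play no role. *)

definition apollonian :: "'a::metric_space set \<Rightarrow> 'a \<Rightarrow> 'a \<Rightarrow> real" where
  "apollonian A x y = (SUP a\<in>bdry A. ln (dist x a / dist y a))"

definition half_apollonian :: "'a::metric_space set \<Rightarrow> 'a \<Rightarrow> 'a \<Rightarrow> real" where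
  "half_apollonian A x y = (SUP a\<in>bdry A. \<bar>ln (dist x a / dist y a)\<bar>)"

definition apollonian_semi :: "'a::metric_space set \<Rightarrow> 'a \<Rightarrow> 'a \<Rightarrow> real" where
  "apollonian_semi A x y =
     (SUP a\<in>bdry A. ln (dist x a / dist y a)) + (SUP b\<in>bdry A. ln (dist y b / dist x b))"

definition max_sym :: "('a \<Rightarrow> 'a \<Rightarrow> real) \<Rightarrow> 'a \<Rightarrow> 'a \<Rightarrow> real" where
  "max_sym \<delta> x y = max (\<delta> x y) (\<delta> y x)"

definition mean_sym :: "('a \<Rightarrow> 'a \<Rightarrow> real) \<Rightarrow> 'a \<Rightarrow> 'a \<Rightarrow> real" where
  "mean_sym \<delta> x y = 1/2 * (\<delta> x y + \<delta> y x)"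

(* With these normalisations mean_sym (apollonian A) and apollonian_semi A differ by a
   factor of two: mean_sym carries the factor 1/2 and apollonian_semi does not.  Equality
   without that factor already fails for the unit ball, in every dimension: *)
lemma mean_sym_apollonian_ne_apollonian_semi:
  fixes e :: "real ^ 'n"
  assumes e: "norm e = 1"
  defines "A \<equiv> ball (0 :: real ^ 'n) 1"
  shows "open A" "bounded A" "0 \<in> A" "(1/2) *\<^sub>R e \<in> A"
    "mean_sym (apollonian A) 0 ((1/2) *\<^sub>R e) \<noteq> apollonian_semi A 0 ((1/2) *\<^sub>R e)"
proof -
  let ?y = "(1/2) *\<^sub>R e"
  show "open A" "bounded A" "0 \<in> A" "?y \<in> A" using e by (auto simp: A_def)
  have B: "bdry A = sphere 0 1" by (auto simp: bdry_def A_def)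
  have d0: "dist 0 a = 1" if "a \<in> sphere 0 1" for a :: "real ^ 'n" using that by simp
  have lo: "dist ?y a \<ge> 1/2" if "a \<in> sphere 0 1" for a
    using that e norm_triangle_ineq2[of a ?y] by (simp add: dist_norm norm_minus_commute)
  have hi: "dist ?y a \<le> 3/2" if "a \<in> sphere 0 1" for a
    using that e norm_triangle_ineq4[of ?y a] by (simp add: dist_norm)
  have "dist ?y e = norm ((-1/2) *\<^sub>R e)"
    unfolding dist_norm by (rule arg_cong[of _ _ norm]) (simp add: vec_eq_iff)
  hence de: "dist ?y e = 1/2" using e by simp
  have "dist ?y (- e) = norm ((3/2) *\<^sub>R e)"
    unfolding dist_norm by (rule arg_cong[of _ _ norm]) (simp add: vec_eq_iff)
  hence dme: "dist ?y (- e) = 3/2" using e by simp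
  have b1: "bdd_above ((\<lambda>a. ln (dist 0 a / dist ?y a)) ` bdry A)"
  proof (rule bdd_aboveI2)
    fix a assume "a \<in> bdry A"
    hence a: "a \<in> sphere 0 1" by (simp add: B)
    have "dist 0 a / dist ?y a \<le> 2" "dist 0 a / dist ?y a > 0"
      using lo[OF a] d0[OF a] by (auto simp add: divide_simps)
    thus "ln (dist 0 a / dist ?y a) \<le> ln 2" by simp
  qed
  have b2: "bdd_above ((\<lambda>a. ln (dist ?y a / dist 0 a)) ` bdry A)"
  proof (rule bdd_aboveI2)
    fix a assume "a \<in> bdry A"
    hence a: "a \<in> sphere 0 1" by (simp add: B)
    have "dist ?y a / dist 0 a \<le> 3/2" "dist ?y a / dist 0 a > 0"
      using lo[OF a] hi[OF a] d0[OF a] by auto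
    thus "ln (dist ?y a / dist 0 a) \<le> ln (3/2)" by simp
  qed
  have "ln (dist 0 e / dist ?y e) \<le> apollonian A 0 ?y"
    unfolding apollonian_def by (rule cSUP_upper[OF _ b1]) (simp add: B e)
  hence p1: "0 < apollonian A 0 ?y" using de e by (simp add: less_le_trans[of 0 "ln 2"])
  have "ln (dist ?y (-e) / dist 0 (-e)) \<le> apollonian A ?y 0"
    unfolding apollonian_def by (rule cSUP_upper[OF _ b2]) (simp add: B e)
  hence p2: "0 < apollonian A ?y 0" using dme e by (simp add: less_le_trans[of 0 "ln (3/2)"])
  have "apollonian_semi A 0 ?y = apollonian A 0 ?y + apollonian A ?y 0"
    by (simp add: apollonian_semi_def apollonian_def)
  with p1 p2 show "mean_sym (apollonian A) 0 ?y \<noteq> apollonian_semi A 0 ?y"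
    by (simp add: mean_sym_def)
qed

end

theory Submission
  imports Defs
begin

text \<open>Swapping \<open>x\<close> and \<open>y\<close> negates the logarithm of the distance
  ratio, so its absolute value is the maximum of the two logarithms, and a supremum of pointwise
  maxima is the maximum of the suprema. For real suprema this interchange relies on a nonempty index
  set (\<open>bdry_nonempty\<close>) and on families bounded above
  (\<open>bdd_above_ln_dist_ratio\<close>). The mean-value identity follows by unfolding.\<close>

lemma bdd_above_ln_dist_ratio:
  fixes A :: "'a::metric_space set"
  assumes "open A" "x \<in> A" "y \<in> A"
  shows "bdd_above ((\<lambda>a. ln (dist x a / dist y a)) ` bdry A)"
proof -
  obtain r where r: "r > 0" "ball y r \<subseteq> A"
    using assms by (meson openE)
  show ?thesis
  proof (rule bdd_aboveI2)
    fix a assume "a \<in> bdry A"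
    then have "a \<notin> A" by (simp add: bdry_def)
    then have far: "r \<le> dist y a" and pos: "0 < dist x a"
      using r(2) \<open>x \<in> A\<close> by (auto simp: subset_iff not_less[symmetric])
    \<comment> \<open>Boundary points stay at distance at least \<open>r\<close> from
      \<open>y\<close>, so the triangle inequality bounds the ratio independently of
      \<open>a\<close>.\<close>
    have "dist x a / dist y a \<le> (dist x y + dist y a) / dist y a"
      by (intro divide_right_mono dist_triangle) simp
    also have "\<dots> = dist x y / dist y a + 1"
      using far r(1) by (auto simp: add_divide_distrib)
    also have "\<dots> \<le> dist x y / r + 1"
      using far r(1) by (simp add: frac_le)
    finally show "ln (dist x a / dist y a) \<le> ln (dist x y / r + 1)"
      using far r(1) pos by (intro ln_mono divide_pos_pos) auto
  qed
qed

text \<open>Without boundary points \<open>A\<close> would be clopen, hence the whole space by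
  connectedness; but it would also be bounded, since the empty set is bounded.\<close>

lemma bdry_nonempty:
  fixes A :: "'a::euclidean_space set"
  assumes "open A" "A \<noteq> {}" "bounded A \<or> \<not> bounded (bdry A)"
  shows "bdry A \<noteq> {}"
proof
  assume "bdry A = {}"
  then have "closed A" "bounded A"
    using assms(3) closure_subset_eq[of A] by (auto simp: bdry_def)
  then show False
    using assms(1,2) clopen[of A] not_bounded_UNIV by auto
qed

lemma max_sym_apollonian:
  fixes A :: "'a::metric_space set"
  assumes "open A" "bdry A \<noteq> {}" "x \<in> A" "y \<in> A"
  shows "max_sym (apollonian A) x y = half_apollonian A x y"
proof -
  let ?f = "\<lambda>u v a. ln (dist u a / dist v a)"
  have "max (?f x y a) (?f y x a) = \<bar>?f x y a\<bar>" if "a \<in> bdry A" for a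
  proof -
    \<comment> \<open>\<open>a\<close> lies outside \<open>A\<close>, so both distances are positive
      and \<open>ln_div\<close> turns each logarithm into a difference.\<close>
    have "0 < dist x a" "0 < dist y a"
      using that assms by (auto simp: bdry_def)
    then show ?thesis by (simp add: ln_div abs_if)
  qed
  then have "(SUP a\<in>bdry A. sup (?f x y a) (?f y x a)) = half_apollonian A x y"
    by (simp add: half_apollonian_def sup_max cong: SUP_cong_simp)
  then show ?thesis
    using SUP_sup_distrib[of "bdry A" "?f x y" "?f y x"] assms
    by (simp add: bdd_above_ln_dist_ratio max_sym_def apollonian_def sup_max)
qed

theorem proposition4p9:
  fixes A :: "(real ^ 'n) set"
  assumes "open A"
    and "bounded A \<or> \<not> bounded (bdry A)"
  shows "(\<forall>x\<in>A. \<forall>y\<in>A. max_sym (apollonian A) x y = half_apollonian A x y)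
       \<and> (\<forall>x\<in>A. \<forall>y\<in>A. mean_sym (apollonian A) x y = 1/2 * apollonian_semi A x y)"
proof (intro conjI ballI)
  fix x y assume xy: "x \<in> A" "y \<in> A"
  then have "bdry A \<noteq> {}"
    using bdry_nonempty assms by blast
  then show "max_sym (apollonian A) x y = half_apollonian A x y"
    using max_sym_apollonian assms(1) xy by blast
  show "mean_sym (apollonian A) x y = 1/2 * apollonian_semi A x y"
    \<comment> \<open>The second supremum in \<open>apollonian_semi A x y\<close> is
      \<open>apollonian A y x\<close>.\<close>
    by (simp add: mean_sym_def apollonian_def apollonian_semi_def)
qed

end
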